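(* Let $(F,\Phi)$ be an $A$-module structure on a $q$-variety $F$ and let $a\in A\setminus\ker\delta$. Then $\mathrm{Tor}(a,F):=\{x\in F:\Phi_a(x)=0\}$ is finite.
   Context: $p$ prime, $K$ algebraically closed of characteristic $p$, $q$ a power of $p$, $\mathbb{F}_q\subset K$. $K\{\tau\}$ is the ring of $\mathbb{F}_q$-linear polynomials $\sum a_iX^{q^i}$; $\Lambda_n$ the polynomials $\sum_{i=1}^nP_i(X_i)$ with $P_i\in K\{\tau\}$. A $q$-variety in $K^n$ is a set $\{x\in K^n: f(x)=0\ \forall f\in S\}$, $S\subset\Lambda_n$; $M(F)=\{f\in\Lambda_n: f|_F=0\}$. Morphisms are maps $x\mapsto(f_1(x),\dots,f_m(x))$ with $f_j\in\Lambda_n$; $\mathrm{End}(F)$ is the ring of morphisms $F\to F$. For $f=\sum_iP_i(X_i)$, $d(f)$ is its linear part (the terms of degree 1); $T(F)=\{x\in K^n: d(f)(x)=0\ \forall f\in M(F)\}$ and $d(\psi)(x)=(d(f_1)(x),\dots,d(f_m)(x))$. $A=\mathbb{F}_q[T]$, $\delta:A\to K$ a fixed $\mathbb{F}_q$-algebra morphism. An $A$-module structure $(F,\Phi)$ is an $\mathbb{F}_q$-algebra morphism $\Phi:A\to\mathrm{End}(F)$ with $d(\Phi_a)=\delta(a)\mathrm{Id}_{T(F)}$ for all $a\in A$. *)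

theory Defs
  imports "HOL-Analysis.Analysis" "HOL-Computational_Algebra.Computational_Algebra"
begin

text \<open>
  Throughout, \<open>'k\<close> plays the role of \<open>K\<close>, and \<open>q\<close> is a power of its characteristic.
  The subfield of \<open>K\<close> with \<open>q\<close> elements is the set of roots of \<open>X\<^sup>q - X\<close>.
\<close>

definition Fq :: "nat \<Rightarrow> 'k::field set"
  where "Fq q = {c. c ^ q = c}"

definition Fq_poly_ring :: "nat \<Rightarrow> 'k::field poly set"
  where "Fq_poly_ring q = {a. \<forall>i. coeff a i \<in> Fq q}"

definition Fq_linear_polys :: "nat \<Rightarrow> 'k::field poly set"
  where "Fq_linear_polys q = {P. \<forall>j. coeff P j \<noteq> 0 \<longrightarrow> (\<exists>i. j = q ^ i)}"

text \<open>
  A polynomial \<open>P\<^sub>1(X\<^sub>1) + \<dots> + P\<^sub>n(X\<^sub>n)\<close> is encoded by the vector of its components \<open>P\<^sub>i\<close>.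
  This loses nothing: the \<open>P\<^sub>i\<close> have no constant term, so they are determined by the sum.
\<close>

definition Lambda :: "nat \<Rightarrow> ('k::field poly ^ 'n) set"
  where "Lambda q = {f. \<forall>i. f $ i \<in> Fq_linear_polys q}"

definition eval :: "'k::field poly ^ 'n \<Rightarrow> 'k ^ 'n \<Rightarrow> 'k"
  where "eval f x = (\<Sum>i\<in>UNIV. poly (f $ i) (x $ i))"

definition q_variety :: "nat \<Rightarrow> ('k::field ^ 'n) set \<Rightarrow> bool"
  where "q_variety q F \<longleftrightarrow> (\<exists>S. S \<subseteq> Lambda q \<and> F = {x. \<forall>f\<in>S. eval f x = 0})"

definition M :: "nat \<Rightarrow> ('k::field ^ 'n) set \<Rightarrow> ('k poly ^ 'n) set"
  where "M q F = {f \<in> Lambda q. \<forall>x\<in>F. eval f x = 0}"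

definition linear_part :: "'k::field poly ^ 'n \<Rightarrow> 'k poly ^ 'n"
  where "linear_part f = (\<chi> i. monom (coeff (f $ i) 1) 1)"

definition tangent_space :: "nat \<Rightarrow> ('k::field ^ 'n) set \<Rightarrow> ('k ^ 'n) set"
  where "tangent_space q F = {x. \<forall>f\<in>M q F. eval (linear_part f) x = 0}"

text \<open>
  Morphisms are functions on the whole ambient space of which only the values on \<open>F\<close> matter;
  \<open>represents q F f \<psi>\<close> says that \<open>\<psi>\<close> is given on \<open>F\<close> by the tuple \<open>f\<close>.
\<close>

definition represents ::
    "nat \<Rightarrow> ('k::field ^ 'n) set \<Rightarrow> 'k poly ^ 'n ^ 'm \<Rightarrow> ('k ^ 'n \<Rightarrow> 'k ^ 'm) \<Rightarrow> bool"
  where "represents q F f \<psi> \<longleftrightarrow>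
    (\<forall>j. f $ j \<in> Lambda q) \<and> (\<forall>x\<in>F. \<psi> x = (\<chi> j. eval (f $ j) x))"

definition Mor ::
    "nat \<Rightarrow> ('k::field ^ 'n) set \<Rightarrow> ('k ^ 'm) set \<Rightarrow> ('k ^ 'n \<Rightarrow> 'k ^ 'm) set"
  where "Mor q F G = {\<psi>. (\<exists>f. represents q F f \<psi>) \<and> \<psi> ` F \<subseteq> G}"

text \<open>
  The differential of a morphism on the tangent space of its source. The lemma
  \<open>differential_eq\<close> shows that it does not depend on the representing tuple, so that the
  description below is proper.
\<close>

definition differential ::
    "nat \<Rightarrow> ('k::field ^ 'n) set \<Rightarrow> ('k ^ 'n \<Rightarrow> 'k ^ 'm) \<Rightarrow> 'k ^ 'n \<Rightarrow> 'k ^ 'm"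
  where "differential q F \<psi> x =
    (THE y. \<exists>f. represents q F f \<psi> \<and> y = (\<chi> j. eval (linear_part (f $ j)) x))"

lemma eval_diff: "eval (f - g) x = eval f x - eval g x"
  by (simp add: eval_def sum_subtractf)

lemma linear_part_diff: "linear_part (f - g) = linear_part f - linear_part g"
  by (simp add: linear_part_def vec_eq_iff diff_monom)

lemma Lambda_diff:
  assumes "f \<in> Lambda q" "g \<in> Lambda q"
  shows "f - g \<in> Lambda q"
  unfolding Lambda_def Fq_linear_polys_def mem_Collect_eq
proof (intro allI impI)
  fix i j assume "coeff ((f - g) $ i) j \<noteq> 0"
  then have "coeff (f $ i) j \<noteq> 0 \<or> coeff (g $ i) j \<noteq> 0" by auto
  with assms show "\<exists>i. j = q ^ i"
    unfolding Lambda_def Fq_linear_polys_def by blast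
qed

lemma differential_eq:
  assumes f: "represents q F f \<psi>" and x: "x \<in> tangent_space q F"
  shows "differential q F \<psi> x = (\<chi> j. eval (linear_part (f $ j)) x)"
  unfolding differential_def
proof (rule the_equality)
  show "\<exists>g. represents q F g \<psi> \<and>
      (\<chi> j. eval (linear_part (f $ j)) x) = (\<chi> j. eval (linear_part (g $ j)) x)"
    using f by blast
next
  fix y assume "\<exists>g. represents q F g \<psi> \<and> y = (\<chi> j. eval (linear_part (g $ j)) x)"
  then obtain g where g: "represents q F g \<psi>"
    and y: "y = (\<chi> j. eval (linear_part (g $ j)) x)" by blast
  have "eval (linear_part (g $ j)) x = eval (linear_part (f $ j)) x" for j
  proof -
    have "eval (g $ j) z = eval (f $ j) z" if "z \<in> F" for z
      using f g that by (simp add: represents_def vec_eq_iff)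
    then have "g $ j - f $ j \<in> M q F"
      using f g by (simp add: M_def Lambda_diff represents_def eval_diff)
    then have "eval (linear_part (g $ j - f $ j)) x = 0"
      using x by (simp only: tangent_space_def mem_Collect_eq)
    then show ?thesis by (simp add: linear_part_diff eval_diff)
  qed
  then show "y = (\<chi> j. eval (linear_part (f $ j)) x)" by (simp add: y)
qed

definition Fq_algebra_morphism_to_field :: "nat \<Rightarrow> ('k::field poly \<Rightarrow> 'k) \<Rightarrow> bool"
  where "Fq_algebra_morphism_to_field q \<delta> \<longleftrightarrow>
    \<delta> 1 = 1 \<and>
    (\<forall>a\<in>Fq_poly_ring q. \<forall>b\<in>Fq_poly_ring q. \<delta> (a + b) = \<delta> a + \<delta> b) \<and>
    (\<forall>a\<in>Fq_poly_ring q. \<forall>b\<in>Fq_poly_ring q. \<delta> (a * b) = \<delta> a * \<delta> b) \<and>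
    (\<forall>c\<in>Fq q. \<forall>a\<in>Fq_poly_ring q. \<delta> (smult c a) = c * \<delta> a)"

text \<open>
  In \<open>End(F)\<close> two elements are equal iff they agree on \<open>F\<close>, addition and the action of
  the subfield \<open>Fq q\<close> are pointwise, and multiplication is composition.
\<close>

definition Fq_algebra_morphism_to_End ::
    "nat \<Rightarrow> ('k::field ^ 'n) set \<Rightarrow> ('k poly \<Rightarrow> 'k ^ 'n \<Rightarrow> 'k ^ 'n) \<Rightarrow> bool"
  where "Fq_algebra_morphism_to_End q F \<Phi> \<longleftrightarrow>
    (\<forall>a\<in>Fq_poly_ring q. \<Phi> a \<in> Mor q F F) \<and>
    (\<forall>x\<in>F. \<Phi> 1 x = x) \<and>
    (\<forall>a\<in>Fq_poly_ring q. \<forall>b\<in>Fq_poly_ring q. \<forall>x\<in>F. \<Phi> (a + b) x = \<Phi> a x + \<Phi> b x) \<and>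
    (\<forall>a\<in>Fq_poly_ring q. \<forall>b\<in>Fq_poly_ring q. \<forall>x\<in>F. \<Phi> (a * b) x = \<Phi> a (\<Phi> b x)) \<and>
    (\<forall>c\<in>Fq q. \<forall>a\<in>Fq_poly_ring q. \<forall>x\<in>F. \<Phi> (smult c a) x = c *s \<Phi> a x)"

definition A_module_structure ::
    "nat \<Rightarrow> ('k::field poly \<Rightarrow> 'k) \<Rightarrow> ('k ^ 'n) set \<Rightarrow> ('k poly \<Rightarrow> 'k ^ 'n \<Rightarrow> 'k ^ 'n) \<Rightarrow> bool"
  where "A_module_structure q \<delta> F \<Phi> \<longleftrightarrow>
    Fq_algebra_morphism_to_End q F \<Phi> \<and>
    (\<forall>a\<in>Fq_poly_ring q. \<forall>x\<in>tangent_space q F. differential q F (\<Phi> a) x = \<delta> a *s x)"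

definition Tor ::
    "('k::field poly \<Rightarrow> 'k ^ 'n \<Rightarrow> 'k ^ 'n) \<Rightarrow> 'k poly \<Rightarrow> ('k ^ 'n) set \<Rightarrow> ('k ^ 'n) set"
  where "Tor \<Phi> a F = {x \<in> F. \<Phi> a x = 0}"

end

theory Submission
  imports Defs
begin

no_notation fps_nth (infixl \<open>$\<close> 75)

text \<open>
  Put \<open>W = Tor \<Phi> a F\<close>. The components of a representative of \<open>\<Phi> a\<close> lie in \<open>M q W\<close>, and on the
  tangent space their linear parts are multiplication by \<open>\<delta> a \<noteq> 0\<close>; so \<open>W\<close> has zero tangent space,
  and \<open>M q W\<close> contains \<open>f\<^sub>1, \<dots>, f\<^sub>n\<close> whose linear parts are the coordinates \<open>X\<^sub>1, \<dots>, X\<^sub>n\<close>.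
  Counting dimensions, the powers \<open>f\<^sub>i\<^bsup>q^k\<^esup>\<close> with \<open>k \<le> N\<close> and the monomials \<open>X\<^sub>j\<^bsup>q^k\<^esup>\<close> with
  \<open>k \<le> N + D\<close> satisfy a nontrivial linear relation over \<open>K\<close> once \<open>N\<close> is large. The terms of least
  degree show that the \<open>f\<^sub>i\<^bsup>q^k\<^esup>\<close> are linearly independent, so the relation involves some power of
  \<open>X\<^sub>j\<close>. Hence the \<open>j\<close>-th coordinate of a point of \<open>W\<close> is a root of a nonzero polynomial.
\<close>

section \<open>Homogeneous linear systems over a field\<close>

text \<open>Gaussian elimination, by induction on the equations: a pivot \<open>i0\<close> removes
  one equation and one unknown, so the unknowns stay in excess. An equation without a pivot is
  trivial and is dropped.\<close>

lemma homogeneous_system_nontrivial_solution: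
  fixes a :: "'i \<Rightarrow> 'j \<Rightarrow> 'k::field"
  assumes "finite J" "finite I" "card J < card I"
  shows "\<exists>c. (\<exists>i\<in>I. c i \<noteq> 0) \<and> (\<forall>j\<in>J. (\<Sum>i\<in>I. c i * a i j) = 0)"
  using assms
proof (induction J arbitrary: I a rule: finite_induct)
  case empty
  then show ?case by (intro exI[of _ "\<lambda>_. 1"]) (auto simp: card_gt_0_iff)
next
  case (insert j J)
  show ?case
  proof (cases "\<forall>i\<in>I. a i j = 0")
    case True
    obtain c where "\<exists>i\<in>I. c i \<noteq> 0" "\<forall>l\<in>J. (\<Sum>i\<in>I. c i * a i l) = 0"
      using insert.IH[of I a] insert.prems insert.hyps by auto
    with True show ?thesis by (intro exI[of _ c]) auto
  next
    case False
    then obtain i0 where i0: "i0 \<in> I" "a i0 j \<noteq> 0" by blast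
    define I' where "I' = I - {i0}"
    have I: "I = insert i0 I'" "i0 \<notin> I'" "finite I'"
      using i0 insert.prems by (auto simp: I'_def)
    have "card J < card I'" using insert.prems insert.hyps I by simp
    then obtain c' where c': "\<exists>i\<in>I'. c' i \<noteq> 0"
      and z: "\<forall>l\<in>J. (\<Sum>i\<in>I'. c' i * (a i l - a i j / a i0 j * a i0 l)) = 0"
      using insert.IH[of I' "\<lambda>i l. a i l - a i j / a i0 j * a i0 l"] I by blast
    \<comment> \<open>Back-substitution: equation \<open>j\<close> forces this value at
      \<open>i0\<close>. Every sum then equals the reduced one, whose coefficients all vanish for
      \<open>l = j\<close>.\<close>
    define c where "c = c'(i0 := - (\<Sum>i\<in>I'. c' i * (a i j / a i0 j)))"
    have eq: "(\<Sum>i\<in>I. c i * a i l) = (\<Sum>i\<in>I'. c' i * (a i l - a i j / a i0 j * a i0 l))" for l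
    proof -
      have "(\<Sum>i\<in>I'. c i * a i l) = (\<Sum>i\<in>I'. c' i * a i l)"
        using I by (intro sum.cong) (auto simp: c_def)
      then show ?thesis
        using I by (simp add: c_def sum_subtractf sum_distrib_left right_diff_distrib mult_ac)
    qed
    have "\<exists>i\<in>I. c i \<noteq> 0" using c' I unfolding c_def by auto
    moreover have "\<forall>l\<in>insert j J. (\<Sum>i\<in>I. c i * a i l) = 0"
      using z i0 by (auto simp: eq)
    ultimately show ?thesis by blast
  qed
qed

section \<open>Closure of \<open>M q F\<close>, expansions and Frobenius\<close>

lemma eval_add: "eval (f + g) x = eval f x + eval g x"
  by (simp add: eval_def sum.distrib)

lemma eval_smult: "eval (\<chi> i. smult c (f $ i)) x = c * eval f x"
  by (simp add: eval_def sum_distrib_left)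

lemma eval_linear_part: "eval (linear_part f) x = (\<Sum>i\<in>UNIV. coeff (f $ i) 1 * x $ i)"
  by (simp add: eval_def linear_part_def poly_monom)

lemma M_add:
  assumes "f \<in> M q F" "g \<in> M q F"
  shows "f + g \<in> M q F"
proof -
  have "f + g \<in> Lambda q"
    unfolding Lambda_def Fq_linear_polys_def mem_Collect_eq
  proof (intro allI impI)
    fix i j assume "coeff ((f + g) $ i) j \<noteq> 0"
    then have "coeff (f $ i) j \<noteq> 0 \<or> coeff (g $ i) j \<noteq> 0" by auto
    with assms show "\<exists>i. j = q ^ i"
      unfolding M_def Lambda_def Fq_linear_polys_def by blast
  qed
  with assms show ?thesis by (simp add: M_def eval_add)
qed

lemma M_smult: "f \<in> M q F \<Longrightarrow> (\<chi> i. smult c (f $ i)) \<in> M q F"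
  by (auto simp: M_def Lambda_def Fq_linear_polys_def eval_smult)

lemma M_antimono: "G \<subseteq> F \<Longrightarrow> M q F \<subseteq> M q G"
  by (auto simp: M_def)

lemma tangent_space_mono: "G \<subseteq> F \<Longrightarrow> tangent_space q G \<subseteq> tangent_space q F"
  using M_antimono[of G F q] by (auto simp: tangent_space_def)

text \<open>\<open>D\<close> bounds the index \<open>m\<close>, not the degree, and may be larger
  than necessary; so the summation range can be adapted to later index shifts.\<close>

lemma poly_Fq_linear:
  assumes P: "P \<in> Fq_linear_polys q" and q: "q > 1" and D: "\<And>m. m > D \<Longrightarrow> coeff P (q ^ m) = 0"
  shows "poly P x = (\<Sum>m\<le>D. coeff P (q ^ m) * x ^ (q ^ m))"
proof -
  have "poly P x = (\<Sum>j\<le>degree P. coeff P j * x ^ j)" by (rule poly_altdef)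
  also have "\<dots> = (\<Sum>j\<in>(\<lambda>m. q ^ m) ` {..D}. coeff P j * x ^ j)"
  proof (rule sum.mono_neutral_cong)
    fix j assume j: "j \<in> {..degree P} - (\<lambda>m. q ^ m) ` {..D}"
    have "coeff P j = 0"
    proof (rule ccontr)
      assume nz: "coeff P j \<noteq> 0"
      then obtain m where m: "j = q ^ m"
        using P unfolding Fq_linear_polys_def by blast
      with nz D[of m] have "m \<le> D" by (metis not_le)
      with m j show False by blast
    qed
    then show "coeff P j * x ^ j = 0" by simp
  next
    fix j assume "j \<in> (\<lambda>m. q ^ m) ` {..D} - {..degree P}"
    then have "j > degree P" by (simp add: not_le)
    then show "coeff P j * x ^ j = 0" by (simp add: coeff_eq_0)
  qed simp_all
  also have "\<dots> = (\<Sum>m\<le>D. coeff P (q ^ m) * x ^ (q ^ m))"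
    using q by (subst sum.reindex) (auto intro!: inj_onI)
  finally show ?thesis .
qed

lemma finite_vec_components:
  assumes "\<And>j. finite (R j)"
  shows "finite {x :: 'a ^ 'n. \<forall>j. x $ j \<in> R j}"
proof -
  have "{x :: 'a ^ 'n. \<forall>j. x $ j \<in> R j} \<subseteq> vec_lambda ` (PiE UNIV R)"
  proof
    fix x :: "'a ^ 'n" assume "x \<in> {x. \<forall>j. x $ j \<in> R j}"
    then show "x \<in> vec_lambda ` (PiE UNIV R)"
      by (intro image_eqI[of _ _ "vec_nth x"]) auto
  qed
  then show ?thesis
    by (rule finite_subset) (intro finite_imageI finite_PiE finite_class.finite_UNIV assms)
qed

lemma Frobenius_sum:
  fixes f :: "'a \<Rightarrow> 'k::field"
  assumes "prime CHAR('k)" "q = CHAR('k) ^ r"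
  shows "sum f A ^ (q ^ k) = (\<Sum>i\<in>A. f i ^ (q ^ k))"
proof -
  have "q ^ k = CHAR('k) ^ (r * k)" using assms by (simp add: power_mult)
  then show ?thesis using assms(1) by (intro freshmans_dream_sum')
qed

section \<open>Common zeros of polynomials with linear parts \<open>X_i\<close>\<close>

lemma coordinate_root_of_nonzero_poly:
  fixes f :: "'n::finite \<Rightarrow> 'k::field poly ^ 'n"
  assumes char: "prime CHAR('k)" and q: "q = CHAR('k) ^ r" "q > 1"
    and f: "\<And>i. f i \<in> Lambda q"
    and lin: "\<And>i l. coeff (f i $ l) 1 = (if i = l then 1 else 0)"
  shows "\<exists>Q. Q \<noteq> 0 \<and> (\<forall>x. (\<forall>i. eval (f i) x = 0) \<longrightarrow> poly Q (x $ j) = 0)"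
proof -
  define D where "D = Max (range (\<lambda>(i, l). degree (f i $ l)))"
  have D: "coeff (f i $ l) (q ^ m) = 0" if "m > D" for i l m
  proof (rule coeff_eq_0)
    have "degree (f i $ l) \<le> D" unfolding D_def by (intro Max_ge) auto
    also have "D < q ^ m" using that q(2) power_gt_expt[of q m] by simp
    finally show "degree (f i $ l) < q ^ m" .
  qed
  \<comment> \<open>With n = \<open>CARD('n)\<close>, there are n(N + 1) + N + D + 1 unknowns and
    n(N + D + 1) equations. The excess N + D + 1 - nD is D + 1 for this \<open>N\<close>.\<close>
  define N where "N = CARD('n) * D"
  define I where "I = ((UNIV :: 'n set) \<times> {..N}) <+> {..N + D}"
  define J where "J = (UNIV :: 'n set) \<times> {..N + D}"
  \<comment> \<open>\<open>a s (l, m)\<close> is the coefficient of \<open>X_l^(q^m)\<close> in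
    \<open>f_i^(q^k)\<close> for \<open>s = Inl (i, k)\<close>, and in \<open>X_j^(q^k)\<close> for
    \<open>s = Inr k\<close>. Frobenius raises coefficients to the power \<open>q ^ k\<close> and
    shifts \<open>m\<close> by \<open>k\<close>.\<close>
  define a :: "'n \<times> nat + nat \<Rightarrow> 'n \<times> nat \<Rightarrow> 'k" where
    "a = (\<lambda>s (l, m). case s of
        Inl (i, k) \<Rightarrow> if k \<le> m then coeff (f i $ l) (q ^ (m - k)) ^ (q ^ k) else 0
      | Inr k \<Rightarrow> if l = j \<and> m = k then 1 else 0)"
  have fin: "finite I" "finite J" by (auto simp: I_def J_def)
  have "card J < card I"
    by (simp add: I_def J_def card_Plus N_def algebra_simps)
  then obtain c where c: "\<exists>s\<in>I. c s \<noteq> 0" and c0: "\<forall>t\<in>J. (\<Sum>s\<in>I. c s * a s t) = 0"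
    using homogeneous_system_nontrivial_solution[of J I a] fin by blast
  define Q where "Q = (\<Sum>k\<le>N + D. monom (c (Inr k)) (q ^ k))"
  have coeff_Q: "coeff Q (q ^ k) = c (Inr k)" if "k \<le> N + D" for k
    using that q(2) by (simp add: Q_def coeff_sum if_distrib[of "\<lambda>b. b = _"])
  have "Q \<noteq> 0"
  proof
    assume "Q = 0"
    then have cR: "c (Inr k) = 0" if "k \<le> N + D" for k using coeff_Q[OF that] by simp
    have sum_I: "(\<Sum>s\<in>I. c s * a s t)
      = (\<Sum>(i, k)\<in>UNIV \<times> {..N}. c (Inl (i, k)) * a (Inl (i, k)) t)" for t
      using cR by (simp add: I_def sum.Plus comp_def split_def)
    \<comment> \<open>Compare coefficients of \<open>X_i^(q^k)\<close>: terms with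
      \<open>k' < k\<close> vanish by induction, those with \<open>k' > k\<close> start in higher
      degree, and for \<open>k' = k\<close> only \<open>f_i\<close> contributes, with coefficient 1
      by \<open>lin\<close>.\<close>
    have "c (Inl (i, k)) = 0" if "k \<le> N" for i k
      using that
    proof (induction k arbitrary: i rule: less_induct)
      case (less k)
      have "(\<Sum>(i', k')\<in>UNIV \<times> {..N}. c (Inl (i', k')) * a (Inl (i', k')) (i, k))
        = (\<Sum>t\<in>UNIV \<times> {..N}. if t = (i, k) then c (Inl (i, k)) else 0)"
      proof (rule sum.cong[OF refl])
        fix t assume "t \<in> (UNIV :: 'n set) \<times> {..N}"
        then obtain i' k' where t: "t = (i', k')" "k' \<le> N" by auto
        consider "k' < k" | "k' = k" | "k' > k" by linarith
        then show "(case t of (i', k') \<Rightarrow> c (Inl (i', k')) * a (Inl (i', k')) (i, k))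
          = (if t = (i, k) then c (Inl (i, k)) else 0)"
        proof cases
          case 1
          then show ?thesis using less.IH[of k' i'] t by simp
        next
          case 2
          then show ?thesis using lin[of i' i] q(2) t by (simp add: a_def)
        next
          case 3
          then show ?thesis using t by (simp add: a_def)
        qed
      qed
      also have "\<dots> = c (Inl (i, k))" using less.prems by (simp add: sum.delta)
      finally show ?case
        using c0 less.prems sum_I[of "(i, k)"] by (simp add: J_def)
    qed
    with cR c show False by (auto simp: I_def)
  qed
  moreover have "poly Q (x $ j) = 0" if x: "\<forall>i. eval (f i) x = 0" for x
  proof -
    have eval_pow: "(\<Sum>(l, m)\<in>J. a (Inl (i, k)) (l, m) * x $ l ^ (q ^ m)) = eval (f i) x ^ (q ^ k)"
      if k: "k \<le> N" for i k
    proof -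
      have "eval (f i) x ^ (q ^ k) = (\<Sum>l\<in>UNIV. poly (f i $ l) (x $ l) ^ (q ^ k))"
        unfolding eval_def by (rule Frobenius_sum[OF char q(1)])
      also have "\<dots> = (\<Sum>l\<in>UNIV. \<Sum>m\<le>N + D. a (Inl (i, k)) (l, m) * x $ l ^ (q ^ m))"
      proof (rule sum.cong[OF refl])
        fix l
        \<comment> \<open>Since \<open>k \<le> N\<close>, the limit \<open>N + D - k\<close> is at
          least \<open>D\<close>, so no term is lost; the shift by \<open>k\<close> turns it into
          \<open>N + D\<close>.\<close>
        have "poly (f i $ l) (x $ l)
          = (\<Sum>m\<le>N + D - k. coeff (f i $ l) (q ^ m) * x $ l ^ (q ^ m))"
          using f[of i] D k by (intro poly_Fq_linear q) (auto simp: Lambda_def)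
        then have "poly (f i $ l) (x $ l) ^ (q ^ k)
          = (\<Sum>m\<le>N + D - k. (coeff (f i $ l) (q ^ m) * x $ l ^ (q ^ m)) ^ (q ^ k))"
          by (simp only: Frobenius_sum[OF char q(1)])
        also have "\<dots>
          = (\<Sum>m\<le>N + D - k. coeff (f i $ l) (q ^ m) ^ (q ^ k) * x $ l ^ (q ^ (m + k)))"
          by (simp only: power_mult_distrib power_add power_mult)
        also have "\<dots> = (\<Sum>m\<in>{k..N + D}. a (Inl (i, k)) (l, m) * x $ l ^ (q ^ m))"
          using k
          by (intro sum.reindex_bij_witness[of _ "\<lambda>m. m - k" "\<lambda>m. m + k"]) (auto simp: a_def)
        also have "\<dots> = (\<Sum>m\<le>N + D. a (Inl (i, k)) (l, m) * x $ l ^ (q ^ m))"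
          by (intro sum.mono_neutral_left) (auto simp: a_def)
        finally show "poly (f i $ l) (x $ l) ^ (q ^ k)
          = (\<Sum>m\<le>N + D. a (Inl (i, k)) (l, m) * x $ l ^ (q ^ m))" .
      qed
      finally show ?thesis by (simp add: J_def sum.cartesian_product)
    qed
    have monomial: "(\<Sum>(l, m)\<in>J. a (Inr k) (l, m) * x $ l ^ (q ^ m)) = x $ j ^ (q ^ k)"
      if k: "k \<le> N + D" for k
    proof -
      have "(\<Sum>(l, m)\<in>J. a (Inr k) (l, m) * x $ l ^ (q ^ m))
        = (\<Sum>t\<in>J. if t = (j, k) then x $ j ^ (q ^ k) else 0)"
        by (intro sum.cong) (simp_all add: a_def split_def prod_eq_iff)
      then show ?thesis using k fin by (simp add: J_def)
    qed
    \<comment> \<open>The relation evaluated at \<open>x\<close>: after exchanging the sums, the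
      \<open>f_i\<close> part vanishes because \<open>x\<close> is a common zero, and
      \<open>poly Q (x $ j)\<close> remains.\<close>
    have "0 = (\<Sum>(l, m)\<in>J. (\<Sum>s\<in>I. c s * a s (l, m)) * x $ l ^ (q ^ m))"
      using c0 by (intro sum.neutral[symmetric]) auto
    also have "\<dots> = (\<Sum>s\<in>I. c s * (\<Sum>(l, m)\<in>J. a s (l, m) * x $ l ^ (q ^ m)))"
      unfolding split_def sum_distrib_left sum_distrib_right
      by (subst sum.swap) (simp add: mult.assoc)
    also have "\<dots> = (\<Sum>(i, k)\<in>UNIV \<times> {..N}. c (Inl (i, k)) * eval (f i) x ^ (q ^ k))
      + (\<Sum>k\<le>N + D. c (Inr k) * x $ j ^ (q ^ k))"
      unfolding I_def
      by (subst sum.Plus) (auto intro!: arg_cong2[of _ _ _ _ "(+)"] sum.cong simp: eval_pow monomial)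
    also have "\<dots> = poly Q (x $ j)"
      using x q(2) by (simp add: Q_def poly_sum poly_monom split_def power_0_left)
    finally show ?thesis by simp
  qed
  ultimately show ?thesis by blast
qed

lemma finite_common_zeros:
  fixes f :: "'n::finite \<Rightarrow> 'k::field poly ^ 'n"
  assumes "prime CHAR('k)" "q = CHAR('k) ^ r" "q > 1"
    and "\<And>i. f i \<in> Lambda q"
    and "\<And>i l. coeff (f i $ l) 1 = (if i = l then 1 else 0)"
  shows "finite {x. \<forall>i. eval (f i) x = 0}"
proof -
  obtain Q where Q: "\<And>j. Q j \<noteq> 0"
    "\<And>j x. \<forall>i. eval (f i) x = 0 \<Longrightarrow> poly (Q j) (x $ j) = 0"
    using coordinate_root_of_nonzero_poly[OF assms] by metis
  have "finite {x. \<forall>j. x $ j \<in> {y. poly (Q j) y = 0}}"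
    using Q(1) by (intro finite_vec_components poly_roots_finite)
  then show ?thesis by (rule rev_finite_subset) (auto intro: Q(2))
qed

section \<open>From zero tangent space to finiteness\<close>

text \<open>The coefficient vectors of linear parts form a subspace \<open>L\<close>, and the
  tangent space is its annihilator under the dot product. A proper subspace would have a nonzero
  annihilator.\<close>

lemma linear_parts_surjective:
  fixes W :: "('k::field ^ 'n) set"
  assumes T: "tangent_space q W \<subseteq> {0}"
  shows "\<exists>f\<in>M q W. (\<chi> i. coeff (f $ i) 1) = v"
proof -
  define L where "L = (\<lambda>f. \<chi> i. coeff (f $ i) 1) ` M q W"
  have "0 \<in> M q W" by (auto simp: M_def Lambda_def Fq_linear_polys_def eval_def)
  then have L: "vec.subspace L"
    unfolding L_def
  proof (intro vec.subspaceI; (elim imageE)?)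
    show "0 \<in> (\<lambda>f. \<chi> i. coeff (f $ i) 1) ` M q W"
      using \<open>0 \<in> M q W\<close> by (intro image_eqI[of _ _ 0]) (simp_all add: vec_eq_iff)
  next
    fix x y f g assume "f \<in> M q W" "g \<in> M q W"
      and "x = (\<chi> i. coeff (f $ i) 1)" "y = (\<chi> i. coeff (g $ i) 1)"
    then show "x + y \<in> (\<lambda>f. \<chi> i. coeff (f $ i) 1) ` M q W"
      by (intro image_eqI[of _ _ "f + g"] M_add) (simp_all add: vec_eq_iff)
  next
    fix c x f assume "f \<in> M q W" and "x = (\<chi> i. coeff (f $ i) 1)"
    then show "c *s x \<in> (\<lambda>f. \<chi> i. coeff (f $ i) 1) ` M q W"
      by (intro image_eqI[of _ _ "\<chi> i. smult c (f $ i)"] M_smult) (simp_all add: vec_eq_iff)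
  qed
  obtain B where B: "B \<subseteq> L" "vec.independent B" "L \<subseteq> vec.span B" "card B = vec.dim L"
    by (rule vec.basis_exists)
  have "\<not> card B < CARD('n)"
  proof
    assume "card B < CARD('n)"
    \<comment> \<open>The elements of \<open>B\<close> serve as equations for the coordinates of
      \<open>c\<close>; a nonzero solution annihilates \<open>L\<close> and is thus a nonzero
      tangent vector.\<close>
    then obtain c where c: "\<exists>i. c i \<noteq> 0" "\<forall>b\<in>B. (\<Sum>i\<in>UNIV. c i * b $ i) = 0"
      using homogeneous_system_nontrivial_solution[of B "UNIV :: 'n set" "\<lambda>i b. b $ i"]
        vec.finiteI_independent[OF B(2)] by auto
    have "vec.subspace {v. (\<Sum>i\<in>UNIV. c i * v $ i) = 0}"
      by (rule vec.subspaceI)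
         (simp_all add: distrib_left sum.distrib mult.left_commute flip: sum_distrib_left)
    with c(2) have "vec.span B \<subseteq> {v. (\<Sum>i\<in>UNIV. c i * v $ i) = 0}"
      by (intro vec.span_minimal) auto
    with B(3) have "\<forall>v\<in>L. (\<Sum>i\<in>UNIV. c i * v $ i) = 0" by auto
    then have "(\<chi> i. c i) \<in> tangent_space q W"
      by (simp add: tangent_space_def eval_linear_part L_def mult.commute)
    with T c(1) show False by (auto simp: vec_eq_iff)
  qed
  then have "vec.dim L = vec.dim (UNIV :: ('k ^ 'n) set)"
    using B(4) vec.dim_subset[of L UNIV] unfolding vec_dim_card by simp
  then have "L = UNIV" using vec.subspace_dim_equal[OF L vec.subspace_UNIV] by auto
  then have "v \<in> L" by simp
  then show ?thesis unfolding L_def by (auto simp del: One_nat_def)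
qed

lemma finite_if_tangent_space_zero:
  fixes W :: "('k::field ^ 'n) set"
  assumes char: "prime CHAR('k)" and q: "q = CHAR('k) ^ r" "q > 1"
    and T: "tangent_space q W \<subseteq> {0}"
  shows "finite W"
proof -
  have "\<forall>l. \<exists>f. f \<in> M q W \<and> (\<chi> i. coeff (f $ i) 1) = axis l 1"
    using linear_parts_surjective[OF T] by blast
  from choice[OF this] obtain f where f: "\<And>l. f l \<in> M q W"
    "\<And>l. (\<chi> i. coeff (f l $ i) 1) = axis l 1"
    by blast
  have "finite {x. \<forall>l. eval (f l) x = 0}"
  proof (rule finite_common_zeros[OF char q])
    fix i l
    show "f i \<in> Lambda q" using f(1)[of i] by (simp add: M_def)
    show "coeff (f i $ l) 1 = (if i = l then 1 else 0)"
      using f(2)[of i] by (auto simp: vec_eq_iff axis_def)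
  qed
  then show ?thesis by (rule rev_finite_subset) (use f(1) in \<open>auto simp: M_def\<close>)
qed

theorem theorem7p2:
  fixes p q r :: nat
    and \<delta> :: "'k::alg_closed_field poly \<Rightarrow> 'k"
    and F :: "('k ^ 'n) set"
    and \<Phi> :: "'k poly \<Rightarrow> 'k ^ 'n \<Rightarrow> 'k ^ 'n"
    and a :: "'k poly"
  assumes "prime p" and "CHAR('k) = p"
    and "r \<ge> 1" and "q = p ^ r"
    and "Fq_algebra_morphism_to_field q \<delta>"
    and "q_variety q F"
    and "A_module_structure q \<delta> F \<Phi>"
    and "a \<in> Fq_poly_ring q" and "\<delta> a \<noteq> 0"
  shows "finite (Tor \<Phi> a F)"
proof (rule finite_if_tangent_space_zero)
  show "prime CHAR('k)" "q = CHAR('k) ^ r" using assms by auto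
  show "q > 1" using assms prime_gt_1_nat[of p] one_less_power[of p r] by simp
  obtain f where f: "represents q F f (\<Phi> a)"
    using assms by (auto simp: A_module_structure_def Fq_algebra_morphism_to_End_def Mor_def)
  show "tangent_space q (Tor \<Phi> a F) \<subseteq> {0}"
  proof
    fix x assume x: "x \<in> tangent_space q (Tor \<Phi> a F)"
    \<comment> \<open>Membership in the larger tangent space makes the differential of
      \<open>\<Phi> a\<close> at \<open>x\<close> computable from \<open>f\<close>, and equal to
      \<open>\<delta> a *s x\<close>.\<close>
    have xF: "x \<in> tangent_space q F"
      using x tangent_space_mono[of "Tor \<Phi> a F" F] by (auto simp: Tor_def)
    have "f $ j \<in> M q (Tor \<Phi> a F)" for j
      using f by (auto simp: represents_def M_def Tor_def vec_eq_iff)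
    then have "eval (linear_part (f $ j)) x = 0" for j
      using x unfolding tangent_space_def by blast
    then have "differential q F (\<Phi> a) x = 0"
      by (simp add: differential_eq[OF f xF] vec_eq_iff)
    moreover have "differential q F (\<Phi> a) x = \<delta> a *s x"
      using assms xF by (simp add: A_module_structure_def)
    ultimately show "x \<in> {0}" using \<open>\<delta> a \<noteq> 0\<close> by (simp add: vec_eq_iff)
  qed
qed

end
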